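(* Let $\mathcal{J}$ be a complex $JB^*$-triple with norm $\|\cdot\|$ and triple product $\{xyz\}$. Let $f, h : \mathcal{J} \to \mathcal{J}$ be mappings with $f(0) = h(0) = 0$ for which there exists a function $\varphi : \mathcal{J}^3 \to [0,\infty)$ such that $$\widetilde{\varphi}(x,y,z) := \sum_{j=0}^{\infty} \frac{1}{2^j}\,\varphi(2^j x, 2^j y, 2^j z) < \infty,$$ $$\|f(\mu x + y) - \mu f(x) - f(y)\| \le \varphi(x,y,0),$$ $$\|h(\mu x + y) - \mu h(x) - h(y)\| \le \varphi(x,y,0),$$ $$\|f(\{xyz\}) - \{f(x)h(y)h(z)\} - \{h(x)f(y)h(z)\} - \{h(x)h(y)f(z)\}\| \le \varphi(x,y,z)$$ for all $x,y,z \in \mathcal{J}$ and all $\mu \in S^1 := \{\lambda \in \mathbb{C} : |\lambda| = 1\}$. Then there exist unique $\mathbb{C}$-linear mappings $D, \theta : \mathcal{J} \to \mathcal{J}$ such that $$\|f(x) - D(x)\| \le \tfrac12 \widetilde{\varphi}(x,x,0) \quad\text{and}\quad \|h(x) - \theta(x)\| \le \tfrac12 \widetilde{\varphi}(x,x,0)$$ for all $x \in \mathcal{J}$. Moreover, $D$ is a $\theta$-derivation on $\mathcal{J}$.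
   Context: A (complex) $JB^*$-triple is a complex Banach space $\mathcal{J}$ with a continuous triple product $\{\cdot,\cdot,\cdot\} : \mathcal{J}\times\mathcal{J}\times\mathcal{J} \to \mathcal{J}$ (also written $\{xyz\} = \{x,y,z\}$), linear in the outer variables and conjugate linear in the middle variable, such that: (i) $\{x,y,z\} = \{z,y,x\}$; (ii) with $L(a,b)x := \{a,b,x\}$, $L(a,b)\{x,y,z\} = \{L(a,b)x,y,z\} - \{x,L(b,a)y,z\} + \{x,y,L(a,b)z\}$ for all $a,b,x,y,z\in\mathcal{J}$; (iii) for all $a \in \mathcal{J}$ the operator $L(a,a)$ is hermitian, i.e. $\|e^{itL(a,a)}\| = 1$ for all $t \in \mathbb{R}$, and has positive (i.e. contained in $[0,\infty)$) spectrum in the Banach algebra $B(\mathcal{J})$ of bounded linear operators on $\mathcal{J}$; (iv) $\|\{x,x,x\}\| = \|x\|^3$ for all $x \in \mathcal{J}$. Given a $\mathbb{C}$-linear mapping $\theta : \mathcal{J} \to \mathcal{J}$, a $\mathbb{C}$-linear mapping $D : \mathcal{J} \to \mathcal{J}$ is called a $\theta$-derivation on $\mathcal{J}$ if $D(\{xyz\}) = \{D(x)\theta(y)\theta(z)\} + \{\theta(x)D(y)\theta(z)\} + \{\theta(x)\theta(y)D(z)\}$ for all $x,y,z \in \mathcal{J}$. No continuity of $D$ or $\theta$ is assumed. *)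

theory Defs
  imports "HOL-Analysis.Analysis"
begin

section \<open>Complex Banach spaces and their bounded operators\<close>

text \<open>
  The real Banach space structure comes from the type class \<open>banach\<close>; the complex scalar
  multiplication is a locale parameter extending the real one.
\<close>

locale complex_banach_space = vector_space scaleC
  for scaleC :: "complex \<Rightarrow> 'a::banach \<Rightarrow> 'a" +
  assumes scaleC_of_real: "scaleC (of_real r) x = r *\<^sub>R x"
    and norm_scaleC: "norm (scaleC c x) = cmod c * norm x"
begin

abbreviation clinear :: "('a \<Rightarrow> 'a) \<Rightarrow> bool" where
  "clinear \<equiv> Vector_Spaces.linear scaleC scaleC"

text \<open>
  The type \<open>'a \<Rightarrow>\<^sub>L 'a\<close> consists of the bounded \<^emph>\<open>real\<close>-linear operators with the operator norm;
  the Banach algebra $B(J)$ is the norm-closed subalgebra of complex-linear ones.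
\<close>

definition cbounded_ops :: "('a \<Rightarrow>\<^sub>L 'a) set" where
  "cbounded_ops = {T. clinear (blinfun_apply T)}"

definition op_scaleC :: "complex \<Rightarrow> ('a \<Rightarrow>\<^sub>L 'a) \<Rightarrow> ('a \<Rightarrow>\<^sub>L 'a)" where
  "op_scaleC c T = Blinfun (\<lambda>x. scaleC c (blinfun_apply T x))"

lemma bounded_linear_scaleC: "bounded_linear (scaleC c)"
proof (rule bounded_linear_intro)
  show "scaleC c (x + y) = scaleC c x + scaleC c y" for x y
    by (rule scale_right_distrib)
  show "scaleC c (r *\<^sub>R x) = r *\<^sub>R scaleC c x" for r x
    by (metis scaleC_of_real scale_left_commute)
  show "norm (scaleC c x) \<le> norm x * cmod c" for x
    by (simp add: norm_scaleC mult.commute)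
qed

lemma op_scaleC_apply: "blinfun_apply (op_scaleC c T) x = scaleC c (blinfun_apply T x)"
  unfolding op_scaleC_def
  by (subst bounded_linear_Blinfun_apply)
    (auto intro: bounded_linear_compose[OF bounded_linear_scaleC] blinfun.bounded_linear_right)

text \<open>The series converges in operator norm.\<close>

definition op_exp :: "('a \<Rightarrow>\<^sub>L 'a) \<Rightarrow> ('a \<Rightarrow>\<^sub>L 'a)" where
  "op_exp T = (\<Sum>n. (1 / fact n) *\<^sub>R (((o\<^sub>L) T ^^ n) id_blinfun))"

definition op_hermitian :: "('a \<Rightarrow>\<^sub>L 'a) \<Rightarrow> bool" where
  "op_hermitian T \<longleftrightarrow> (\<forall>t::real. norm (op_exp (op_scaleC (\<i> * of_real t) T)) = 1)"

definition op_spectrum :: "('a \<Rightarrow>\<^sub>L 'a) \<Rightarrow> complex set" where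
  "op_spectrum T =
    {c. \<not> (\<exists>S\<in>cbounded_ops.
            S o\<^sub>L (T - op_scaleC c id_blinfun) = id_blinfun \<and>
            (T - op_scaleC c id_blinfun) o\<^sub>L S = id_blinfun)}"

end


section \<open>JB*-triples\<close>

locale continuous_triple = complex_banach_space scaleC
  for scaleC :: "complex \<Rightarrow> 'a::banach \<Rightarrow> 'a" +
  fixes triple :: "'a \<Rightarrow> 'a \<Rightarrow> 'a \<Rightarrow> 'a"
  assumes triple_continuous: "continuous_on UNIV (\<lambda>(x, y, z). triple x y z)"
    and triple_linear_left: "clinear (\<lambda>x. triple x y z)"
    and triple_linear_right: "clinear (\<lambda>z. triple x y z)"
    and triple_add_middle: "triple x (y + y') z = triple x y z + triple x y' z"
    and triple_scale_middle: "triple x (scaleC c y) z = scaleC (cnj c) (triple x y z)"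
begin

definition L :: "'a \<Rightarrow> 'a \<Rightarrow> ('a \<Rightarrow>\<^sub>L 'a)" where
  "L a b = Blinfun (\<lambda>x. triple a b x)"

lemma bounded_linear_triple: "bounded_linear (\<lambda>x. triple a b x)"
proof -
  interpret lin: Vector_Spaces.linear scaleC scaleC "\<lambda>x. triple a b x"
    by (rule triple_linear_right)
  have scaleR: "triple a b (r *\<^sub>R x) = r *\<^sub>R triple a b x" for r x
    by (metis scaleC_of_real lin.scale)
  have "continuous_on UNIV ((\<lambda>(x, y, z). triple x y z) \<circ> (\<lambda>x. (a, b, x)))"
    by (intro continuous_on_compose continuous_intros continuous_on_subset[OF triple_continuous]) auto
  then have cont: "isCont (\<lambda>x. triple a b x) 0"
    by (simp add: o_def continuous_on_eq_continuous_at)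
  then obtain d where d: "d > 0" "\<And>x. norm x < d \<Longrightarrow> norm (triple a b x) < 1"
    unfolding continuous_at_eps_delta dist_norm
    by (metis diff_zero lin.zero zero_less_one)
  show ?thesis
  proof (rule bounded_linear_intro)
    show "triple a b (x + y) = triple a b x + triple a b y" for x y
      by (rule lin.add)
    show "triple a b (r *\<^sub>R x) = r *\<^sub>R triple a b x" for r x
      by (rule scaleR)
    show "norm (triple a b x) \<le> norm x * (2 / d)" for x
    proof (cases "x = 0")
      case False
      define r where "r = d / (2 * norm x)"
      have "r > 0" using d False by (simp add: r_def)
      have "norm (r *\<^sub>R x) < d" using d False by (simp add: r_def)
      then have "r * norm (triple a b x) < 1"
        using d(2)[of "r *\<^sub>R x"] \<open>r > 0\<close> by (simp add: scaleR)
      then show ?thesis using d False by (simp add: r_def field_simps)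
    qed simp
  qed
qed

lemma L_apply: "blinfun_apply (L a b) x = triple a b x"
  unfolding L_def by (simp add: bounded_linear_Blinfun_apply bounded_linear_triple)

end

locale jb_star_triple = continuous_triple scaleC triple
  for scaleC :: "complex \<Rightarrow> 'a::banach \<Rightarrow> 'a"
    and triple :: "'a \<Rightarrow> 'a \<Rightarrow> 'a \<Rightarrow> 'a" +
  assumes triple_commute: "triple x y z = triple z y x"
    and jordan_identity:
      "blinfun_apply (L a b) (triple x y z) =
        triple (blinfun_apply (L a b) x) y z - triple x (blinfun_apply (L b a) y) z
          + triple x y (blinfun_apply (L a b) z)"
    and L_hermitian: "op_hermitian (L a a)"
    and L_positive_spectrum: "op_spectrum (L a a) \<subseteq> complex_of_real ` {0..}"
    and norm_cube: "norm (triple x x x) = norm x ^ 3"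
begin

definition theta_derivation :: "('a \<Rightarrow> 'a) \<Rightarrow> ('a \<Rightarrow> 'a) \<Rightarrow> bool" where
  "theta_derivation \<theta> D \<longleftrightarrow> clinear \<theta> \<and> clinear D \<and>
    (\<forall>x y z. D (triple x y z) =
      triple (D x) (\<theta> y) (\<theta> z) + triple (\<theta> x) (D y) (\<theta> z) + triple (\<theta> x) (\<theta> y) (D z))"

end


section \<open>The control function\<close>

definition dyadic_term :: "('a::real_vector \<Rightarrow> 'a \<Rightarrow> 'a \<Rightarrow> real) \<Rightarrow> 'a \<Rightarrow> 'a \<Rightarrow> 'a \<Rightarrow> nat \<Rightarrow> real" where
  "dyadic_term \<phi> x y z j = 1 / 2 ^ j * \<phi> (2 ^ j *\<^sub>R x) (2 ^ j *\<^sub>R y) (2 ^ j *\<^sub>R z)"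

definition dyadic_sum :: "('a::real_vector \<Rightarrow> 'a \<Rightarrow> 'a \<Rightarrow> real) \<Rightarrow> 'a \<Rightarrow> 'a \<Rightarrow> 'a \<Rightarrow> real" where
  "dyadic_sum \<phi> x y z = (\<Sum>j. dyadic_term \<phi> x y z j)"

end

theory Submission
  imports Defs
begin

text \<open>
  Hyers' direct method: the dyadic averages $f(2^n x)/2^n$ form a Cauchy sequence whose limit
  $D$ is additive and commutes with unimodular scalars. Every complex number is a natural multiple
  of a sum of two unimodular numbers, so $D$ is complex linear without any continuity. Evaluating
  the derivation estimate at $2^n x, 2^n y, 2^n z$ and dividing by $8^n$ gives the derivation
  identity in the limit, because $f(8^n w)/8^n$ is a subsequence of the dyadic averages of $f$
  at $w$ and the triple product is jointly continuous.
\<close>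

section \<open>Complex scalars from unimodular ones\<close>

lemma complex_sum_of_two_unimodular:
  assumes "cmod c \<le> 2"
  obtains u v where "cmod u = 1" "cmod v = 1" "c = u + v"
proof
  define a where "a = Arg c"
  \<comment> \<open>Unit vectors at angle \<open>b\<close> on either side of the direction of
    \<open>c\<close> span a rhombus with diagonal \<open>c\<close>, so \<open>2 * cos b\<close> must
    equal \<open>cmod c\<close>. The bound by 2 keeps the argument of \<open>arccos\<close> in its
    domain.\<close>
  define b where "b = arccos (cmod c / 2)"
  have cos: "cos b = cmod c / 2"
    unfolding b_def using assms norm_ge_zero[of c] by (intro cos_arccos) linarith+
  show "cmod (cis (a + b)) = 1" "cmod (cis (a - b)) = 1" by simp_all
  have "cis (a + b) + cis (a - b) = of_real (2 * cos b) * cis a"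
    by (simp add: complex_eq_iff cos_add sin_add cos_diff sin_diff)
  also have "\<dots> = c"
    using rcis_cmod_Arg[of c] by (simp add: cos rcis_def a_def)
  finally show "c = cis (a + b) + cis (a - b)" ..
qed

context complex_banach_space
begin

lemma clinearI_unimodular:
  assumes add: "\<And>x y. D (x + y) = D x + D y"
    and unimodular: "\<And>\<mu> x. cmod \<mu> = 1 \<Longrightarrow> D (scaleC \<mu> x) = scaleC \<mu> (D x)"
  shows "clinear D"
proof (unfold_locales)
  have zero: "D 0 = 0" using add[of 0 0] by simp
  have of_nat: "D (scaleC (of_nat n) x) = scaleC (of_nat n) (D x)" for n x
    by (induction n) (simp_all add: zero add scale_left_distrib)
  show "D (scaleC c x) = scaleC c (D x)" for c x
  proof -
    obtain n where n: "cmod c \<le> real n"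
      using real_arch_simple by blast
    \<comment> \<open>The successor keeps the divisor nonzero even if \<open>n = 0\<close>, which is
      possible for \<open>c = 0\<close>.\<close>
    define m where "m = Suc n"
    have "cmod (c / of_nat m) \<le> 2"
      using n by (simp add: m_def norm_divide divide_le_eq norm_of_nat del: of_nat_Suc) simp
    then obtain u v where uv: "cmod u = 1" "cmod v = 1" "c / of_nat m = u + v"
      by (rule complex_sum_of_two_unimodular)
    have c: "c = of_nat m * (u + v)"
      using uv(3) by (simp add: m_def field_simps del: of_nat_Suc)
    have "D (scaleC c x) = D (scaleC (of_nat m) (scaleC u x + scaleC v x))"
      by (simp add: c flip: scale_left_distrib)
    also have "\<dots> = scaleC (of_nat m) (scaleC u (D x) + scaleC v (D x))"
      by (simp only: of_nat add unimodular uv)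
    also have "\<dots> = scaleC c (D x)"
      by (simp add: c flip: scale_left_distrib)
    finally show ?thesis .
  qed
qed (rule add)

lemma clinear_scaleR:
  assumes "clinear D"
  shows "D (r *\<^sub>R x) = r *\<^sub>R D x"
proof -
  interpret Vector_Spaces.linear scaleC scaleC D by (rule assms)
  show ?thesis by (metis scaleC_of_real scale)
qed

end

section \<open>Dyadic averages and their limit\<close>

definition dyadic_avg :: "('a::real_vector \<Rightarrow> 'b::real_vector) \<Rightarrow> 'a \<Rightarrow> nat \<Rightarrow> 'b" where
  "dyadic_avg f x n = (1 / 2 ^ n) *\<^sub>R f (2 ^ n *\<^sub>R x)"

text \<open>Lets the uniqueness argument read a rescaled bound at 2^n x as a tail of the series at
  x.\<close>

lemma dyadic_term_scale:
  "dyadic_term \<phi> (2 ^ n *\<^sub>R x) (2 ^ n *\<^sub>R y) (2 ^ n *\<^sub>R z) j / 2 ^ n = dyadic_term \<phi> x y z (j + n)"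
  by (simp add: dyadic_term_def power_add)

text \<open>Collects what \<open>f\<close> and \<open>h\<close> have in common, so that the limit is
  constructed once and instantiated for both.\<close>

locale approx_linear = complex_banach_space scaleC
  for scaleC :: "complex \<Rightarrow> 'a::banach \<Rightarrow> 'a" +
  fixes f :: "'a \<Rightarrow> 'a" and \<phi> :: "'a \<Rightarrow> 'a \<Rightarrow> 'a \<Rightarrow> real"
  assumes summable_dyadic_term: "summable (dyadic_term \<phi> x y z)"
    and approx: "cmod \<mu> = 1 \<Longrightarrow> norm (f (scaleC \<mu> x + y) - scaleC \<mu> (f x) - f y) \<le> \<phi> x y 0"
begin

lemma dyadic_term_tendsto_0: "dyadic_term \<phi> x y z \<longlonglongrightarrow> 0"
  by (rule summable_LIMSEQ_zero[OF summable_dyadic_term])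

text \<open>With w = 2^n x, the hypothesis for \<mu> = 1 and both arguments w bounds f(2w) - 2 f(w)
  by \<phi>(w, w, 0). Dividing by 2^(n+1) instead of 2^n produces the factor 1/2 of the final
  estimate.\<close>

lemma norm_dyadic_avg_Suc_diff:
  "norm (dyadic_avg f x (Suc n) - dyadic_avg f x n) \<le> dyadic_term \<phi> x x 0 n / 2"
proof -
  let ?w = "2 ^ n *\<^sub>R x"
  have one: "scaleC 1 y = y" for y by simp
  have eq: "dyadic_avg f x (Suc n) - dyadic_avg f x n
      = (1 / 2 ^ Suc n) *\<^sub>R (f (?w + ?w) - f ?w - f ?w)"
  proof -
    have "?w + ?w = 2 ^ Suc n *\<^sub>R x" by (simp flip: scaleR_2)
    moreover have "(1 / 2 ^ Suc n) *\<^sub>R (f ?w + f ?w) = (1 / 2 ^ n) *\<^sub>R f ?w"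
      by (simp flip: scaleR_2)
    ultimately show ?thesis
      by (simp only: dyadic_avg_def scaleR_diff_right[symmetric] diff_diff_eq)
        (simp only: scaleR_diff_right)
  qed
  show ?thesis
    unfolding eq using approx[of 1 ?w ?w]
    by (simp add: one dyadic_term_def divide_right_mono mult.commute)
qed

text \<open>The increments telescope down to the average of index 0, which is \<open>f x\<close>
  itself.\<close>

lemma norm_dyadic_avg_diff:
  "norm (dyadic_avg f x n - f x) \<le> (\<Sum>j<n. dyadic_term \<phi> x x 0 j) / 2"
proof -
  have "norm (dyadic_avg f x n - f x) = norm (\<Sum>j<n. dyadic_avg f x (Suc j) - dyadic_avg f x j)"
    by (subst sum_lessThan_telescope) (simp add: dyadic_avg_def)
  also have "\<dots> \<le> (\<Sum>j<n. dyadic_term \<phi> x x 0 j / 2)"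
    by (intro sum_norm_le norm_dyadic_avg_Suc_diff)
  finally show ?thesis by (simp add: sum_divide_distrib)
qed

text \<open>The increments are dominated by a summable series, so they are summable by completeness,
  and their partial sums telescope.\<close>

lemma convergent_dyadic_avg: "convergent (dyadic_avg f x)"
proof -
  have "summable (\<lambda>n. dyadic_avg f x (Suc n) - dyadic_avg f x n)"
    by (rule summable_comparison_test'[OF summable_divide[OF summable_dyadic_term]])
      (rule norm_dyadic_avg_Suc_diff)
  then have "convergent (\<lambda>n. f x + (\<Sum>j<n. dyadic_avg f x (Suc j) - dyadic_avg f x j))"
    by (intro convergent_add convergent_const) (simp add: summable_iff_convergent)
  also have "(\<lambda>n. f x + (\<Sum>j<n. dyadic_avg f x (Suc j) - dyadic_avg f x j)) = dyadic_avg f x"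
    by (subst sum_lessThan_telescope) (simp add: dyadic_avg_def fun_eq_iff)
  finally show ?thesis .
qed

definition limit_map :: "'a \<Rightarrow> 'a" where
  "limit_map x = lim (dyadic_avg f x)"

lemma dyadic_avg_tendsto: "dyadic_avg f x \<longlonglongrightarrow> limit_map x"
  using convergent_dyadic_avg unfolding limit_map_def by (simp add: convergent_LIMSEQ_iff)

text \<open>Passes to the limit in the finite bound \<open>norm_dyadic_avg_diff\<close>.\<close>

lemma norm_limit_map_diff: "norm (f x - limit_map x) \<le> 1 / 2 * dyadic_sum \<phi> x x 0"
proof -
  have "(\<lambda>n. norm (dyadic_avg f x n - f x)) \<longlonglongrightarrow> norm (limit_map x - f x)"
    by (intro tendsto_intros dyadic_avg_tendsto)
  moreover have "(\<lambda>n. (\<Sum>j<n. dyadic_term \<phi> x x 0 j) / 2) \<longlonglongrightarrow> dyadic_sum \<phi> x x 0 / 2"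
    unfolding dyadic_sum_def by (intro tendsto_intros summable_LIMSEQ summable_dyadic_term) simp
  ultimately have "norm (limit_map x - f x) \<le> dyadic_sum \<phi> x x 0 / 2"
    by (rule LIMSEQ_le) (use norm_dyadic_avg_diff in blast)
  then show ?thesis by (simp add: norm_minus_commute)
qed

text \<open>The defect of the n-th averages is at most the n-th term of a convergent series, hence
  vanishes in the limit. Additivity and homogeneity are special cases.\<close>

lemma limit_map_unimodular:
  assumes \<mu>: "cmod \<mu> = 1"
  shows "limit_map (scaleC \<mu> x + y) = scaleC \<mu> (limit_map x) + limit_map y"
proof -
  interpret S: bounded_linear "scaleC \<mu>" by (rule bounded_linear_scaleC)
  let ?d = "\<lambda>n. dyadic_avg f (scaleC \<mu> x + y) n - scaleC \<mu> (dyadic_avg f x n) - dyadic_avg f y n"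
  have "norm (?d n) \<le> dyadic_term \<phi> x y 0 n" for n
  proof -
    have "?d n = (1 / 2 ^ n) *\<^sub>R (f (scaleC \<mu> (2 ^ n *\<^sub>R x) + 2 ^ n *\<^sub>R y)
        - scaleC \<mu> (f (2 ^ n *\<^sub>R x)) - f (2 ^ n *\<^sub>R y))"
      by (simp only: dyadic_avg_def S.scaleR scaleR_diff_right scaleR_add_right)
    then show ?thesis
      using approx[OF \<mu>, of "2 ^ n *\<^sub>R x" "2 ^ n *\<^sub>R y"]
      by (simp add: dyadic_term_def divide_right_mono)
  qed
  then have "?d \<longlonglongrightarrow> 0"
    by (intro Lim_null_comparison[OF always_eventually dyadic_term_tendsto_0] allI)
  moreover have "?d \<longlonglongrightarrow> limit_map (scaleC \<mu> x + y) - scaleC \<mu> (limit_map x) - limit_map y"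
    by (intro tendsto_intros S.tendsto dyadic_avg_tendsto)
  ultimately have "limit_map (scaleC \<mu> x + y) - scaleC \<mu> (limit_map x) - limit_map y = 0"
    by (rule LIMSEQ_unique[rotated])
  then show ?thesis by (simp add: algebra_simps)
qed

lemma clinear_limit_map: "clinear limit_map"
proof (rule clinearI_unimodular)
  show add: "limit_map (x + y) = limit_map x + limit_map y" for x y
    using limit_map_unimodular[of 1 x y] by simp
  show "limit_map (scaleC \<mu> x) = scaleC \<mu> (limit_map x)" if "cmod \<mu> = 1" for \<mu> x
    \<comment> \<open>Choosing y = 0 leaves the summand \<open>limit_map 0\<close>, which is zero by
      additivity at 0 + 0.\<close>
    using limit_map_unimodular[OF that, of x 0] add[of 0 0] by simp
qed

text \<open>
  A complex linear map within the bound is itself the limit of the dyadic averages, since the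
  bound at $2^n x$ divided by $2^n$ is a tail of the series at $x$.
\<close>

lemma limit_map_unique:
  assumes lin: "clinear D" and bound: "\<And>x. norm (f x - D x) \<le> 1 / 2 * dyadic_sum \<phi> x x 0"
  shows "D = limit_map"
proof
  fix x
  let ?tail = "\<lambda>n. \<Sum>j. dyadic_term \<phi> x x 0 (j + n)"
  have "norm (dyadic_avg f x n - D x) \<le> 1 / 2 * ?tail n" for n
  proof -
    let ?w = "2 ^ n *\<^sub>R x"
    have "dyadic_avg f x n - D x = (1 / 2 ^ n) *\<^sub>R (f ?w - D ?w)"
      by (simp add: dyadic_avg_def clinear_scaleR[OF lin] scaleR_diff_right)
    then have "norm (dyadic_avg f x n - D x) = norm (f ?w - D ?w) / 2 ^ n"
      by simp
    also have "\<dots> \<le> 1 / 2 * dyadic_sum \<phi> ?w ?w 0 / 2 ^ n"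
      by (intro divide_right_mono bound) simp
    also have "\<dots> = 1 / 2 * (dyadic_sum \<phi> ?w ?w 0 / 2 ^ n)"
      by simp
    also have "dyadic_sum \<phi> ?w ?w 0 / 2 ^ n = ?tail n"
      using dyadic_term_scale[of \<phi> n x x 0]
      by (simp add: dyadic_sum_def summable_dyadic_term flip: suminf_divide)
    finally show ?thesis .
  qed
  moreover have "(\<lambda>n. 1 / 2 * ?tail n) \<longlonglongrightarrow> 0"
    by (intro tendsto_mult_right_zero suminf_exist_split2 summable_dyadic_term)
  ultimately have "(\<lambda>n. dyadic_avg f x n - D x) \<longlonglongrightarrow> 0"
    by (rule Lim_null_comparison[OF always_eventually[OF allI]])
  then have "dyadic_avg f x \<longlonglongrightarrow> D x"
    by (simp add: LIM_zero_iff)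
  then show "D x = limit_map x"
    using dyadic_avg_tendsto by (rule LIMSEQ_unique)
qed

end

section \<open>The derivation identity in the limit\<close>

context continuous_triple
begin

lemma tendsto_triple:
  assumes "(u \<longlongrightarrow> a) F" "(v \<longlongrightarrow> b) F" "(w \<longlongrightarrow> c) F"
  shows "((\<lambda>n. triple (u n) (v n) (w n)) \<longlongrightarrow> triple a b c) F"
  using isCont_tendsto_compose[OF
      triple_continuous[unfolded continuous_on_eq_continuous_at[OF open_UNIV], rule_format]
      tendsto_Pair[OF assms(1) tendsto_Pair[OF assms(2,3)]]]
  by simp

text \<open>Conjugation fixes real scalars, so the conjugate linear middle variable behaves like the
  outer ones.\<close>

lemma triple_scaleR:
  "triple (r *\<^sub>R x) (s *\<^sub>R y) (t *\<^sub>R z) = (r * s * t) *\<^sub>R triple x y z"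
proof -
  have "triple x (s *\<^sub>R y) z = s *\<^sub>R triple x y z" for x z
    using triple_scale_middle[of x "of_real s" y z] by (simp add: scaleC_of_real)
  then show ?thesis
    by (simp add: clinear_scaleR[OF triple_linear_left] clinear_scaleR[OF triple_linear_right]
        mult.assoc)
qed

lemma approx_derivation_limit:
  fixes f h :: "'a \<Rightarrow> 'a" and D \<theta> \<phi>
  assumes summable: "summable (dyadic_term \<phi> x y z)"
    and nonneg: "\<And>n. 0 \<le> dyadic_term \<phi> x y z n"
    and D: "\<And>x. dyadic_avg f x \<longlonglongrightarrow> D x"
    and \<theta>: "\<And>x. dyadic_avg h x \<longlonglongrightarrow> \<theta> x"
    and approx: "\<And>x y z.
      norm (f (triple x y z) - triple (f x) (h y) (h z) - triple (h x) (f y) (h z)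
        - triple (h x) (h y) (f z)) \<le> \<phi> x y z"
  shows "D (triple x y z) =
    triple (D x) (\<theta> y) (\<theta> z) + triple (\<theta> x) (D y) (\<theta> z) + triple (\<theta> x) (\<theta> y) (D z)"
proof -
  \<comment> \<open>The index \<open>n * 3\<close> matches the factor 8^n = 2^(3n) that the triple
    product extracts from three arguments scaled by 2^n.\<close>
  let ?d = "\<lambda>n. dyadic_avg f (triple x y z) (n * 3)
    - triple (dyadic_avg f x n) (dyadic_avg h y n) (dyadic_avg h z n)
    - triple (dyadic_avg h x n) (dyadic_avg f y n) (dyadic_avg h z n)
    - triple (dyadic_avg h x n) (dyadic_avg h y n) (dyadic_avg f z n)"
  have "norm (?d n) \<le> dyadic_term \<phi> x y z n" for n
  proof -
    let ?x = "2 ^ n *\<^sub>R x" and ?y = "2 ^ n *\<^sub>R y" and ?z = "2 ^ n *\<^sub>R z"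
    let ?e = "f (triple ?x ?y ?z) - triple (f ?x) (h ?y) (h ?z) - triple (h ?x) (f ?y) (h ?z)
      - triple (h ?x) (h ?y) (f ?z)"
    have cube: "(2::real) ^ (n * 3) = 2 ^ n * 2 ^ n * 2 ^ n"
      by (simp add: power_mult power3_eq_cube)
    have "?d n = (1 / 2 ^ (n * 3)) *\<^sub>R ?e"
      by (simp add: dyadic_avg_def triple_scaleR scaleR_diff_right cube)
    then have "norm (?d n) \<le> \<phi> ?x ?y ?z / 2 ^ (n * 3)"
      using approx[of ?x ?y ?z] by (simp add: divide_right_mono)
    also have "\<dots> = dyadic_term \<phi> x y z n / (2 ^ n * 2 ^ n)"
      by (simp add: dyadic_term_def cube)
    \<comment> \<open>Only 2^n of the divisor 8^n is absorbed by the dyadic term. The remaining 4^n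
      is at least 1, and nonnegativity of the term allows it to be dropped.\<close>
    also have "\<dots> \<le> dyadic_term \<phi> x y z n / 1"
      by (intro divide_left_mono nonneg) (simp_all add: one_le_power flip: power_add)
    finally show ?thesis by simp
  qed
  then have "?d \<longlonglongrightarrow> 0"
    by (intro Lim_null_comparison[OF always_eventually summable_LIMSEQ_zero[OF summable]] allI)
  moreover have "(\<lambda>n. dyadic_avg f (triple x y z) (n * 3)) \<longlonglongrightarrow> D (triple x y z)"
    using LIMSEQ_subseq_LIMSEQ[OF D, of "\<lambda>n. n * 3"] by (simp add: strict_mono_def o_def)
  then have "?d \<longlonglongrightarrow> D (triple x y z)
    - triple (D x) (\<theta> y) (\<theta> z) - triple (\<theta> x) (D y) (\<theta> z) - triple (\<theta> x) (\<theta> y) (D z)"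
    by (intro tendsto_diff tendsto_triple D \<theta>)
  ultimately have "D (triple x y z)
    - triple (D x) (\<theta> y) (\<theta> z) - triple (\<theta> x) (D y) (\<theta> z) - triple (\<theta> x) (\<theta> y) (D z) = 0"
    by (rule LIMSEQ_unique[rotated])
  then show ?thesis by (simp add: algebra_simps)
qed

end

theorem theorem2p1:
  fixes scaleC :: "complex \<Rightarrow> 'a::banach \<Rightarrow> 'a"
    and triple :: "'a \<Rightarrow> 'a \<Rightarrow> 'a \<Rightarrow> 'a"
    and f h :: "'a \<Rightarrow> 'a"
    and \<phi> :: "'a \<Rightarrow> 'a \<Rightarrow> 'a \<Rightarrow> real"
  assumes J: "jb_star_triple scaleC triple"
    and f0: "f 0 = 0" and h0: "h 0 = 0"
    and phi_nonneg: "\<And>x y z. 0 \<le> \<phi> x y z"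
    and phi_summable: "\<And>x y z. summable (dyadic_term \<phi> x y z)"
    and f_approx: "\<And>\<mu> x y. cmod \<mu> = 1 \<Longrightarrow>
      norm (f (scaleC \<mu> x + y) - scaleC \<mu> (f x) - f y) \<le> \<phi> x y 0"
    and h_approx: "\<And>\<mu> x y. cmod \<mu> = 1 \<Longrightarrow>
      norm (h (scaleC \<mu> x + y) - scaleC \<mu> (h x) - h y) \<le> \<phi> x y 0"
    and fh_approx: "\<And>x y z.
      norm (f (triple x y z) - triple (f x) (h y) (h z) - triple (h x) (f y) (h z)
        - triple (h x) (h y) (f z)) \<le> \<phi> x y z"
  shows "\<exists>D \<theta>.
    (Vector_Spaces.linear scaleC scaleC D \<and> Vector_Spaces.linear scaleC scaleC \<theta> \<and>
      (\<forall>x. norm (f x - D x) \<le> 1 / 2 * dyadic_sum \<phi> x x 0) \<and>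
      (\<forall>x. norm (h x - \<theta> x) \<le> 1 / 2 * dyadic_sum \<phi> x x 0)) \<and>
    (\<forall>D' \<theta>'.
      Vector_Spaces.linear scaleC scaleC D' \<and> Vector_Spaces.linear scaleC scaleC \<theta>' \<and>
      (\<forall>x. norm (f x - D' x) \<le> 1 / 2 * dyadic_sum \<phi> x x 0) \<and>
      (\<forall>x. norm (h x - \<theta>' x) \<le> 1 / 2 * dyadic_sum \<phi> x x 0)
      \<longrightarrow> D' = D \<and> \<theta>' = \<theta>) \<and>
    jb_star_triple.theta_derivation scaleC triple \<theta> D"
proof -
  interpret jb_star_triple scaleC triple by (rule J)
  interpret F: approx_linear scaleC f \<phi>
    by unfold_locales (rule phi_summable, rule f_approx)
  interpret H: approx_linear scaleC h \<phi>
    by unfold_locales (rule phi_summable, rule h_approx)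
  have nonneg: "0 \<le> dyadic_term \<phi> x y z n" for x y z n
    by (simp add: dyadic_term_def phi_nonneg)
  have "theta_derivation H.limit_map F.limit_map"
    unfolding theta_derivation_def
    using approx_derivation_limit[OF phi_summable nonneg F.dyadic_avg_tendsto
        H.dyadic_avg_tendsto fh_approx]
    by (simp add: F.clinear_limit_map H.clinear_limit_map)
  \<comment> \<open>The two bounds constrain D' and \<theta>' separately, so uniqueness of the pair
    follows from uniqueness of each limit map.\<close>
  moreover have "D' = F.limit_map \<and> \<theta>' = H.limit_map"
    if "clinear D' \<and> clinear \<theta>' \<and>
      (\<forall>x. norm (f x - D' x) \<le> 1 / 2 * dyadic_sum \<phi> x x 0) \<and>
      (\<forall>x. norm (h x - \<theta>' x) \<le> 1 / 2 * dyadic_sum \<phi> x x 0)" for D' \<theta>'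
    using that F.limit_map_unique[of D'] H.limit_map_unique[of \<theta>'] by simp
  ultimately show ?thesis
    using F.clinear_limit_map H.clinear_limit_map F.norm_limit_map_diff H.norm_limit_map_diff
    by (intro exI[of _ F.limit_map] exI[of _ H.limit_map] conjI allI impI) (assumption | simp)+
qed

end
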